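(* Let $\lambda = \frac{\log 2}{\log \varphi}$ where $\varphi = \frac{1+\sqrt5}{2}$, and define \[ c_1 = \liminf_{H \to \infty} \frac{A(H)}{H^{\lambda}}, \qquad c_2 = \limsup_{H \to \infty} \frac{A(H)}{H^{\lambda}}. \] Then \[ 0.525347 < c_1 < 0.525349, \qquad 0.5433878 < c_2 < 0.5433893. \] In particular $c_1 = 0.52534\ldots$ and $c_2 = 0.54338\ldots$.
   Context: The Fibonacci numbers are $F_1 = F_2 = 1$, $F_{m+1} = F_m + F_{m-1}$. For $n \in \mathbb{Z}_{\ge 0}$, $R(n)$ is the number of solutions to $x_1 + \cdots + x_s = n$ with $s \in \mathbb{Z}_{\ge 0}$ and $x_1 < \cdots < x_s$ Fibonacci numbers (partitions of $n$ into distinct Fibonacci numbers; $R(0)=1$). For $H \in \mathbb{Z}$, $A(H) = \sum_{n=0}^{H} R(n)$. *)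

theory Defs
  imports Complex_Main "HOL-Library.Extended_Real" "HOL-Library.Liminf_Limsup" "HOL-Number_Theory.Fib"
begin

definition golden_ratio :: real where
  "golden_ratio = (1 + sqrt 5) / 2"

(* The image of fib over indices >= 1 is a set of values, so F_1 = F_2 = 1 provides a single part. *)
definition fibonacci_numbers :: "nat set" where
  "fibonacci_numbers = fib ` {1..}"

definition fib_partitions :: "nat \<Rightarrow> nat list set" where
  "fib_partitions n =
     {xs. sorted_wrt (<) xs \<and> set xs \<subseteq> fibonacci_numbers \<and> sum_list xs = n}"

definition R :: "nat \<Rightarrow> nat" where
  "R n = card (fib_partitions n)"

definition A :: "int \<Rightarrow> nat" where
  "A H = (\<Sum>n\<in>{0..H}. R (nat n))"

definition fib_exponent :: real where
  "fib_exponent = ln 2 / ln golden_ratio"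

end

theory Submission
  imports Defs "HOL-Analysis.Convex"
begin

text \<open>
  With \<open>\<phi>\<close> the golden ratio, \<open>A(x \<phi>\<^sup>m\<^sup>+\<^sup>2 / \<surd>5) / 2\<^sup>m\<close> converges uniformly to a monotone function \<open>G\<close>
  on \<open>[0, \<phi>]\<close>.  Deciding whether the largest possible part is used, and complementing the set of the
  remaining parts if it is not, gives \<open>G(\<phi> x) = 2 G(x)\<close> and
  \<open>G(x) = 1 + G(x - 1) - G(\<phi> - x)\<close> for \<open>1 \<le> x \<le> \<phi>\<close>; hence \<open>G\<close> has explicit rational values on a dense
  subset of \<open>\<int>[\<phi>]\<close>.  The limits inferior and superior are the extrema over \<open>[1, \<phi>]\<close> of \<open>G(x) / g(x)\<close>,
  where \<open>g(x) = (\<phi>\<^sup>2 x / \<surd>5)\<^sup>\<lambda>\<close>.  On an interval \<open>[u, v]\<close> this quotient lies between \<open>G(u) / g(v)\<close> and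
  \<open>G(v) / g(u)\<close>, so a few hundred intervals suffice for the bounds, and two well-chosen points give the
  opposite bounds.  Powers \<open>y\<^sup>\<lambda>\<close> are bounded without logarithms: \<open>\<phi>\<^sup>\<lambda> = 2\<close> gives \<open>y\<^sup>\<lambda> = 2\<^sup>j\<^sup>/\<^sup>N\<close> for
  \<open>y = \<phi>\<^sup>j\<^sup>/\<^sup>N\<close>, and \<open>u\<^sup>2 / (1 + (2 - \<lambda>)(u - 1)) \<le> u\<^sup>\<lambda> \<le> u (1 + (\<lambda> - 1)(u - 1))\<close> handles ratios \<open>u\<close>
  near \<open>1\<close>.  With rational slopes in place of \<open>\<lambda> - 1\<close> and \<open>2 - \<lambda>\<close>, the remaining comparisons take
  place in \<open>\<int>[\<phi>]\<close>, where they are decided exactly.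
\<close>

section \<open>Counting partitions into distinct Fibonacci numbers\<close>

definition F :: "nat \<Rightarrow> nat" where
  "F m = fib (m + 2)"

lemma F_0 [simp]: "F 0 = 1"
  by (simp add: F_def)

lemma F_1 [simp]: "F (Suc 0) = 2"
  by (simp add: F_def)

lemma F_Suc_Suc [simp]: "F (Suc (Suc m)) = F (Suc m) + F m"
  by (simp add: F_def)

lemma F_pos [simp]: "0 < F m"
  by (simp add: F_def fib_neq_0_nat)

lemma strict_mono_F: "strict_mono F"
proof (rule strict_mono_Suc_iff[THEN iffD2], rule allI)
  show "F m < F (Suc m)" for m by (cases m) auto
qed

lemma F_less_iff [simp]: "F k < F m \<longleftrightarrow> k < m"
  by (rule strict_mono_less[OF strict_mono_F])

lemma F_Suc_le: "F (Suc m) \<le> 2 * F m"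
  by (cases m) (use F_less_iff[of "m - 1" m] in \<open>auto simp del: F_less_iff\<close>)

lemma inj_F: "inj_on F S"
  using strict_mono_F by (meson inj_on_subset strict_mono_imp_inj_on subset_UNIV)

lemma fibonacci_numbers_eq_range: "fibonacci_numbers = range F"
proof (intro equalityI subsetI)
  fix x assume "x \<in> fibonacci_numbers"
  then obtain k where k: "1 \<le> k" "x = fib k" by (auto simp: fibonacci_numbers_def)
  show "x \<in> range F"
  proof (cases "k = 1")
    case True
    then have "x = F 0" using k by simp
    then show ?thesis by blast
  next
    case False
    then have "k = k - 2 + 2" using k(1) by simp
    then have "x = F (k - 2)" unfolding F_def k(2) by (rule arg_cong)
    then show ?thesis by blast
  qed
next
  show "x \<in> fibonacci_numbers" if "x \<in> range F" for x
    using that unfolding fibonacci_numbers_def F_def by (auto simp del: fib.simps intro!: imageI)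
qed

definition subset_count :: "nat \<Rightarrow> int \<Rightarrow> nat" where
  "subset_count m h = card {I. I \<subseteq> {..<m} \<and> int (sum F I) \<le> h}"

lemma subset_count_0: "subset_count 0 h = (if 0 \<le> h then 1 else 0)"
proof -
  have "{I :: nat set. I \<subseteq> {..<0} \<and> int (sum F I) \<le> h} = (if 0 \<le> h then {{}} else {})"
    by auto
  then show ?thesis by (simp add: subset_count_def)
qed

lemma subset_count_Suc:
  "subset_count (Suc m) h = subset_count m h + subset_count m (h - int (F m))"
proof -
  let ?S = "\<lambda>h. {I. I \<subseteq> {..<m} \<and> int (sum F I) \<le> h}"
  have fin: "finite (?S h)" for h
    by (rule finite_subset[of _ "Pow {..<m}"]) auto
  have insert: "int (sum F (insert m I)) = int (F m) + int (sum F I)" if "I \<subseteq> {..<m}" for I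
  proof -
    have "finite I" "m \<notin> I" using that finite_subset by auto
    then show ?thesis by simp
  qed
  have inj: "inj_on (insert m) (?S (h - int (F m)))"
    by (rule inj_on_inverseI[where g = "\<lambda>I. I - {m}"]) auto
  have disjoint: "?S h \<inter> insert m ` ?S (h - int (F m)) = {}"
    by auto
  have "{I. I \<subseteq> {..<Suc m} \<and> int (sum F I) \<le> h} = ?S h \<union> insert m ` ?S (h - int (F m))"
    (is "?L = ?R")
  proof (intro equalityI subsetI)
    fix I assume I: "I \<in> ?L"
    show "I \<in> ?R"
    proof (cases "m \<in> I")
      case True
      then obtain J where J: "I = insert m J" "m \<notin> J" by (rule mk_disjoint_insert[elim_format]) blast
      then have "J \<subseteq> {..<m}" using I by (auto simp: lessThan_Suc)
      then show ?thesis using I insert[of J] by (auto simp: J(1))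
    qed (use I in \<open>auto simp: lessThan_Suc\<close>)
  qed (use insert in \<open>auto simp: lessThan_Suc\<close>)
  then show ?thesis
    by (simp only: subset_count_def card_Un_disjoint[OF fin finite_imageI[OF fin] disjoint] card_image[OF inj])
qed

lemma subset_count_neg: "h < 0 \<Longrightarrow> subset_count m h = 0"
  by (induction m arbitrary: h) (auto simp: subset_count_0 subset_count_Suc)

text \<open>Complementation in \<open>{..<m}\<close>, where \<open>F\<close> sums to \<open>F (Suc m) - 2\<close>.\<close>

lemma subset_count_reflect:
  "subset_count m h + subset_count m (int (F (Suc m)) - 3 - h) = 2 ^ m"
proof (induction m arbitrary: h)
  case (Suc m)
  have shift: "int (F (Suc (Suc m))) - 3 - h = int (F (Suc m)) - 3 - (h - int (F m))"
    "int (F (Suc m)) - 3 - (h - int (F m)) - int (F m) = int (F (Suc m)) - 3 - h"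
    by simp_all
  show ?case
    using Suc.IH[of h] Suc.IH[of "h - int (F m)"]
    unfolding subset_count_Suc shift power_Suc by linarith
qed (auto simp: subset_count_0)

lemma subset_count_top: "int (F (Suc m)) - 2 \<le> h \<Longrightarrow> subset_count m h = 2 ^ m"
  using subset_count_reflect[of m h] by (simp add: subset_count_neg)

lemma subset_count_le: "subset_count m h \<le> 2 ^ m"
  using subset_count_reflect[of m h] by linarith

text \<open>When \<open>m\<close> grows by two, the four translates of the previous increments fall into two pairs with
  disjoint supports.\<close>

lemma subset_count_increment:
  defines "d \<equiv> \<lambda>m n. int (subset_count m n) - int (subset_count m (n - 1))"
  shows "0 \<le> d m n \<and> d m n \<le> 2 ^ (m div 2)"
proof (induction m arbitrary: n rule: induct_nat_012)
  case (ge2 m)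
  let ?f = "int (F m)" and ?g = "int (F (Suc m))"
  have split: "d (Suc (Suc m)) n = (d m n + d m (n - ?g)) + (d m (n - ?f) + d m (n - ?f - ?g))"
    by (simp add: d_def subset_count_Suc algebra_simps)
  have pair: "0 \<le> d m k + d m (k - ?g) \<and> d m k + d m (k - ?g) \<le> 2 ^ (m div 2)" for k
  proof (cases "k < ?g")
    case True
    then have "d m (k - ?g) = 0" by (simp add: d_def subset_count_neg)
    with ge2.IH(1)[of k] show ?thesis by simp
  next
    case False
    then have "d m k = 0" by (simp add: d_def subset_count_top)
    with ge2.IH(1)[of "k - ?g"] show ?thesis by simp
  qed
  show ?case unfolding split using pair[of n] pair[of "n - ?f"] by simp
qed (auto simp: d_def subset_count_0 subset_count_Suc)

lemma subset_count_lipschitz: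
  assumes "h \<le> h'"
  shows "real (subset_count m h') \<le> real (subset_count m h) + of_int (h' - h) * 2 ^ (m div 2)"
  using assms
proof (induction h' rule: int_ge_induct)
  case (step i)
  have "int (subset_count m (i + 1)) \<le> int (subset_count m i + 2 ^ (m div 2))"
    using subset_count_increment[of m "i + 1"] by simp
  then have "real (subset_count m (i + 1)) \<le> real (subset_count m i + 2 ^ (m div 2))"
    unfolding of_nat_le_iff .
  with step.IH show ?case by (simp add: algebra_simps)
qed simp

lemma R_eq_card: "R n = card {I. finite I \<and> sum F I = n}"
proof -
  have "bij_betw (\<lambda>I. sorted_list_of_set (F ` I)) {I. finite I \<and> sum F I = n} (fib_partitions n)"
  proof (rule bij_betw_byWitness[where f' = "\<lambda>xs. F -` set xs"])
    show "\<forall>I\<in>{I. finite I \<and> sum F I = n}. F -` set (sorted_list_of_set (F ` I)) = I"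
      by (auto dest: injD[OF inj_F])
    show "\<forall>xs\<in>fib_partitions n. sorted_list_of_set (F ` (F -` set xs)) = xs"
      by (auto simp: fib_partitions_def fibonacci_numbers_eq_range strict_sorted_iff
          sorted_list_of_set.idem_if_sorted_distinct image_vimage_eq Int_absorb2)
    show "(\<lambda>I. sorted_list_of_set (F ` I)) ` {I. finite I \<and> sum F I = n} \<subseteq> fib_partitions n"
    proof (rule image_subsetI)
      fix I assume "I \<in> {I. finite I \<and> sum F I = n}"
      then have "finite (F ` I)" "sum F I = n" by auto
      moreover from this have "sum_list (sorted_list_of_set (F ` I)) = n"
        using sum_list_distinct_conv_sum_set[of "sorted_list_of_set (F ` I)" "\<lambda>x. x"]
        by (simp add: sum.reindex[OF inj_F])
      ultimately show "sorted_list_of_set (F ` I) \<in> fib_partitions n"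
        by (simp add: fib_partitions_def fibonacci_numbers_eq_range image_mono)
    qed
    have "sum F (F -` set xs) = sum_list xs"
      if "sorted_wrt (<) xs" "set xs \<subseteq> range F" for xs
    proof -
      have "sum F (F -` set xs) = \<Sum>(F ` (F -` set xs))"
        by (simp only: sum.reindex[OF inj_F] o_def)
      also have "\<dots> = sum_list xs"
        using that sum_list_distinct_conv_sum_set[of xs "\<lambda>x. x"]
        by (simp add: image_vimage_eq Int_absorb2[OF that(2)] strict_sorted_iff)
      finally show ?thesis .
    qed
    then show "(\<lambda>xs. F -` set xs) ` fib_partitions n \<subseteq> {I. finite I \<and> sum F I = n}"
      by (auto simp: fib_partitions_def fibonacci_numbers_eq_range intro: finite_vimageI inj_F)
  qed
  then show ?thesis unfolding R_def by (rule bij_betw_same_card[symmetric])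
qed

lemma R_eq_card_bounded:
  assumes "n < F m"
  shows "R n = card {I. I \<subseteq> {..<m} \<and> sum F I = n}"
proof -
  have "I \<subseteq> {..<m}" if I: "finite I" "sum F I = n" for I
  proof
    fix i assume "i \<in> I"
    then have "F i \<le> sum F I" using I(1) by (intro member_le_sum) auto
    also have "\<dots> < F m" using I(2) assms by simp
    finally show "i \<in> {..<m}" by simp
  qed
  then have "{I. finite I \<and> sum F I = n} = {I. I \<subseteq> {..<m} \<and> sum F I = n}"
    using finite_subset by blast
  then show ?thesis by (simp add: R_eq_card)
qed

lemma A_eq_subset_count:
  assumes "h < int (F m)"
  shows "A h = subset_count m h"
proof -
  have "A h = (\<Sum>n\<in>{0..h}. card {I. I \<subseteq> {..<m} \<and> int (sum F I) = n})"
    unfolding A_def using assms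
    by (intro sum.cong refl)
      (subst R_eq_card_bounded[of _ m], auto intro!: arg_cong[of _ _ card] simp del: of_nat_sum)
  also have "\<dots> = card (\<Union>n\<in>{0..h}. {I. I \<subseteq> {..<m} \<and> int (sum F I) = n})"
    by (subst card_UN_disjoint) (auto intro: finite_subset[of _ "Pow {..<m}"])
  also have "(\<Union>n\<in>{0..h}. {I. I \<subseteq> {..<m} \<and> int (sum F I) = n}) =
      {I. I \<subseteq> {..<m} \<and> int (sum F I) \<le> h}"
    by (auto simp del: of_nat_sum)
  finally show ?thesis by (simp add: subset_count_def)
qed

lemma A_mono: "h \<le> h' \<Longrightarrow> A h \<le> A h'"
  unfolding A_def by (intro sum_mono2) auto

lemma A_le_power: "h < int (F m) \<Longrightarrow> A h \<le> 2 ^ m"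
  by (simp add: A_eq_subset_count subset_count_le)

lemma A_floor_lipschitz:
  assumes "u < real (F m)" "v < real (F m)"
  shows "\<bar>real (A \<lfloor>u\<rfloor>) - real (A \<lfloor>v\<rfloor>)\<bar> \<le> (\<bar>u - v\<bar> + 1) * 2 ^ (m div 2)"
proof -
  have ordered: "\<bar>real (A \<lfloor>u\<rfloor>) - real (A \<lfloor>v\<rfloor>)\<bar> \<le> (\<bar>u - v\<bar> + 1) * 2 ^ (m div 2)"
    if uv: "v \<le> u" and "u < real (F m)" for u v :: real
  proof -
    have "\<lfloor>u\<rfloor> < int (F m)" "\<lfloor>v\<rfloor> < int (F m)"
      using that by linarith+
    then have "real (A \<lfloor>u\<rfloor>) \<le> real (A \<lfloor>v\<rfloor>) + of_int (\<lfloor>u\<rfloor> - \<lfloor>v\<rfloor>) * 2 ^ (m div 2)"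
      using floor_mono[OF uv] by (simp add: A_eq_subset_count[of _ m] subset_count_lipschitz del: of_int_diff)
    also have "of_int (\<lfloor>u\<rfloor> - \<lfloor>v\<rfloor>) * 2 ^ (m div 2) \<le> (\<bar>u - v\<bar> + 1) * 2 ^ (m div 2)"
      using uv by (intro mult_right_mono) (linarith, simp)
    finally show ?thesis using A_mono[OF floor_mono[OF uv]] by simp
  qed
  show ?thesis
    using ordered[of v u] ordered[of u v] assms by (cases "v \<le> u") (simp_all add: abs_minus_commute)
qed

text \<open>Either the part \<open>F m\<close> is used, or the set of the smaller parts is complemented.\<close>

lemma A_recurrence:
  assumes "h < int (F (Suc m))" "int (F (Suc m)) - 3 - int (F m) < h"
  shows "real (A h) = 2 ^ m + real (A (h - int (F m))) - real (A (int (F (Suc m)) - 3 - h))"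
proof -
  have "A (h - int (F m)) = subset_count m (h - int (F m))"
    "A (int (F (Suc m)) - 3 - h) = subset_count m (int (F (Suc m)) - 3 - h)"
    using assms F_Suc_le[of m] by (auto intro!: A_eq_subset_count)
  moreover have "real (subset_count m h) + real (subset_count m (int (F (Suc m)) - 3 - h)) = 2 ^ m"
    using subset_count_reflect[of m h] by (metis of_nat_add of_nat_numeral of_nat_power)
  ultimately show ?thesis
    using A_eq_subset_count[OF assms(1)] by (simp add: subset_count_Suc)
qed

section \<open>The limit function\<close>

abbreviation phi :: real ("\<phi>") where
  "\<phi> \<equiv> golden_ratio"

definition psi :: real ("\<psi>") where
  "\<psi> = \<phi> - 1"

lemma phi_mult_self: "\<phi> * \<phi> = \<phi> + 1"
  by (simp add: golden_ratio_def field_simps)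

lemma phi_mult_psi: "\<phi> * \<psi> = 1"
  using phi_mult_self by (simp add: psi_def algebra_simps)

lemma phi_bounds: "3/2 < \<phi>" "\<phi> < 2"
proof -
  have "2 < sqrt 5" "sqrt 5 < 3"
    by (auto intro: real_less_rsqrt real_less_lsqrt)
  then show "3/2 < \<phi>" "\<phi> < 2" by (auto simp: golden_ratio_def)
qed

lemma phi_pos [simp]: "0 < \<phi>" "0 \<le> \<phi>" "\<phi> \<noteq> 0" "1 < \<phi>" "1 \<le> \<phi>"
  using phi_bounds by auto

lemma psi_bounds [simp]: "0 < \<psi>" "0 \<le> \<psi>" "\<psi> \<noteq> 0" "\<psi> < 1" "\<psi> \<le> 1"
  using phi_bounds by (auto simp: psi_def)

definition \<theta> :: "nat \<Rightarrow> real" where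
  "\<theta> m = \<phi> ^ (m + 2) / sqrt 5"

lemma theta_pos [simp]: "0 < \<theta> m"
  by (simp add: \<theta>_def)

lemma theta_neq_0 [simp]: "\<theta> m \<noteq> 0"
  by (simp add: \<theta>_def)

lemma theta_Suc: "\<theta> (Suc m) = \<phi> * \<theta> m"
  by (simp add: \<theta>_def)

lemma F_theta: "\<bar>real (F m) - \<theta> m\<bar> \<le> 1"
proof -
  have "int (F m) = round (\<theta> m)"
    using fib_closed_form'[of "m + 2"] unfolding F_def \<theta>_def golden_ratio_def by simp
  then have "real (F m) = of_int (round (\<theta> m))"
    by (metis of_int_of_nat_eq)
  then show ?thesis
    using of_int_round_abs_le[of "\<theta> m"] by simp
qed

definition scaled_count :: "nat \<Rightarrow> real \<Rightarrow> real" where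
  "scaled_count m x = real (A \<lfloor>x * \<theta> m\<rfloor>) / 2 ^ m"

lemma scaled_count_Suc: "scaled_count (Suc m) x = scaled_count m (\<phi> * x) / 2"
  by (simp add: scaled_count_def theta_Suc mult_ac)

lemma scaled_count_nonneg: "0 \<le> scaled_count m x"
  by (simp add: scaled_count_def)

lemma scaled_count_mono: "x \<le> y \<Longrightarrow> scaled_count m x \<le> scaled_count m y"
  unfolding scaled_count_def
  by (intro divide_right_mono of_nat_mono A_mono floor_mono mult_right_mono)
    (auto simp: less_imp_le)

lemma mult_theta_less_F:
  assumes "x \<le> \<phi>"
  shows "x * \<theta> m < real (F (m + 3))"
proof -
  have "x * \<theta> m \<le> \<theta> (Suc m)"
    using assms by (simp add: theta_Suc mult_right_mono less_imp_le)
  also have "\<dots> \<le> real (F (Suc m)) + 1"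
    using F_theta[of "Suc m"] by linarith
  also have "\<dots> < real (F (m + 3))"
    using F_pos[of m] F_pos[of "Suc m"] by (simp add: eval_nat_numeral del: F_pos)
  finally show ?thesis .
qed

lemma scaled_count_le:
  assumes "x \<le> \<phi>"
  shows "scaled_count m x \<le> 8"
proof -
  have "\<lfloor>x * \<theta> m\<rfloor> < int (F (m + 3))"
    using mult_theta_less_F[OF assms] by (simp add: floor_less_iff)
  then have "real (A \<lfloor>x * \<theta> m\<rfloor>) \<le> real (2 ^ (m + 3))"
    by (intro of_nat_mono A_le_power)
  then show ?thesis
    by (simp add: scaled_count_def power_add field_simps)
qed

lemma power_half_le: "2 ^ ((m + 3) div 2) \<le> 4 * (3 / 2 :: real) ^ m"
proof (induction m rule: induct_nat_012)
  case (ge2 m)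
  have "(Suc (Suc m) + 3) div 2 = Suc ((m + 3) div 2)" by linarith
  then have "2 ^ ((Suc (Suc m) + 3) div 2) = (2 * 2 ^ ((m + 3) div 2) :: real)" by (simp only: power_Suc)
  also have "\<dots> \<le> 8 * (3 / 2) ^ m" using ge2.IH(1) by simp
  also have "\<dots> \<le> 4 * (3 / 2) ^ Suc (Suc m)" by simp
  finally show ?case .
qed simp_all

lemma A_floor_mult_theta_near:
  assumes "z \<le> \<phi>" "k < int (F (m + 3))" "\<bar>z * \<theta> m - of_int k\<bar> \<le> c"
  shows "\<bar>real (A \<lfloor>z * \<theta> m\<rfloor>) - real (A k)\<bar> \<le> (c + 1) * 2 ^ ((m + 3) div 2)"
proof -
  have "\<bar>real (A \<lfloor>z * \<theta> m\<rfloor>) - real (A \<lfloor>of_int k :: real\<rfloor>)\<bar>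
      \<le> (\<bar>z * \<theta> m - of_int k\<bar> + 1) * 2 ^ ((m + 3) div 2)"
    using assms(2) by (intro A_floor_lipschitz mult_theta_less_F assms(1)) linarith
  also have "\<dots> \<le> (c + 1) * 2 ^ ((m + 3) div 2)"
    using assms(3) by (intro mult_right_mono) auto
  finally show ?thesis by simp
qed

lemma scaled_count_recurrence:
  assumes "1 \<le> x" "x \<le> \<phi>"
  shows "\<bar>scaled_count m x - (1 + scaled_count m (x - 1) - scaled_count m (\<phi> - x))\<bar> \<le> 56 * (3 / 4) ^ m"
proof -
  let ?L = "2 ^ ((m + 3) div 2) :: real"
  define a where "a z = real (A \<lfloor>z * \<theta> m\<rfloor>)" for z
  define h where "h = min \<lfloor>x * \<theta> m\<rfloor> (int (F (Suc m)) - 1)"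
  have x\<theta>: "\<theta> m \<le> x * \<theta> m" "x * \<theta> m \<le> \<theta> (Suc m)"
    using assms by (auto simp: theta_Suc)
  have F: "\<bar>real (F m) - \<theta> m\<bar> \<le> 1" "\<bar>real (F (Suc m)) - \<theta> (Suc m)\<bar> \<le> 1"
    by (rule F_theta)+
  have F_mono: "F m < F (Suc m)" "F (Suc m) < F (m + 3)"
    by (simp_all only: F_less_iff)
  have h: "\<bar>x * \<theta> m - of_int h\<bar> \<le> 2" "int (F m) - 2 < h" "h < int (F (Suc m))"
    using x\<theta> F F_mono unfolding h_def by linarith+
  have "\<bar>a x - real (A h)\<bar> \<le> (2 + 1) * ?L"
    using assms h F_mono unfolding a_def by (intro A_floor_mult_theta_near) (auto simp del: F_less_iff)
  moreover have "\<bar>a (x - 1) - real (A (h - int (F m)))\<bar> \<le> (3 + 1) * ?L"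
    using assms h F F_mono unfolding a_def
    by (intro A_floor_mult_theta_near) (auto simp: left_diff_distrib simp del: F_less_iff)
  moreover have "\<bar>a (\<phi> - x) - real (A (int (F (Suc m)) - 3 - h))\<bar> \<le> (6 + 1) * ?L"
    using assms h F F_mono unfolding a_def
    by (intro A_floor_mult_theta_near) (auto simp: left_diff_distrib theta_Suc simp del: F_less_iff)
  moreover have "real (A h) = 2 ^ m + real (A (h - int (F m))) - real (A (int (F (Suc m)) - 3 - h))"
    using h F_Suc_le[of m] by (intro A_recurrence) auto
  ultimately have "\<bar>a x - (2 ^ m + a (x - 1) - a (\<phi> - x))\<bar> \<le> 14 * ?L"
    by (simp add: abs_le_iff)
  also have "\<dots> \<le> 56 * (3 / 4) ^ m * 2 ^ m"
    using power_half_le[of m] by (simp flip: power_mult_distrib)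
  finally have "\<bar>(a x - (2 ^ m + a (x - 1) - a (\<phi> - x))) / 2 ^ m\<bar> \<le> 56 * (3 / 4) ^ m"
    by (simp add: abs_divide pos_divide_le_eq)
  also have "(a x - (2 ^ m + a (x - 1) - a (\<phi> - x))) / 2 ^ m =
      scaled_count m x - (1 + scaled_count m (x - 1) - scaled_count m (\<phi> - x))"
    by (simp add: scaled_count_def a_def diff_divide_distrib add_divide_distrib)
  finally show ?thesis .
qed

lemma scaled_count_diff_le: "x \<le> \<phi> \<Longrightarrow> \<bar>scaled_count m x - scaled_count n x\<bar> \<le> 8"
  using scaled_count_le[of x m] scaled_count_le[of x n] scaled_count_nonneg[of m x] scaled_count_nonneg[of n x]
  by linarith

text \<open>Both arguments on the right-hand side of the recurrence lie in \<open>[0, \<psi>]\<close>, where two applications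
  of the scaling rule divide the increments by four.\<close>

lemma scaled_count_increment:
  assumes "0 \<le> x" "x \<le> \<phi>"
  shows "\<bar>scaled_count (Suc m) x - scaled_count m x\<bar> \<le> 1000 * (3 / 4) ^ m"
  using assms
proof (induction m arbitrary: x rule: induct_nat_012)
  case 0
  then show ?case using scaled_count_diff_le[of x "Suc 0" 0] by simp
next
  case 1
  then show ?case using scaled_count_diff_le[of x "Suc (Suc 0)" "Suc 0"] by simp
next
  case (ge2 m)
  define d where "d n y = scaled_count (Suc n) y - scaled_count n y" for n y
  have d_Suc: "d (Suc n) y = d n (\<phi> * y) / 2" for n y
    by (simp add: d_def scaled_count_Suc diff_divide_distrib)
  let ?m = "Suc (Suc m)"
  have "\<bar>d ?m x\<bar> \<le> 1000 * (3 / 4) ^ ?m"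
  proof (cases "x \<le> 1")
    case True
    then have "\<bar>d (Suc m) (\<phi> * x)\<bar> \<le> 1000 * (3 / 4) ^ Suc m"
      unfolding d_def using ge2.prems by (intro ge2.IH) auto
    then show ?thesis by (simp add: d_Suc[of "Suc m"])
  next
    case False
    have small: "\<bar>d ?m y\<bar> \<le> 250 * (3 / 4) ^ m" if y: "0 \<le> y" "y \<le> \<psi>" for y
    proof -
      have "\<phi> * y \<le> 1"
        using mult_left_mono[OF y(2), of \<phi>] phi_mult_psi by simp
      then have "\<bar>d m (\<phi> * (\<phi> * y))\<bar> \<le> 1000 * (3 / 4) ^ m"
        unfolding d_def using y by (intro ge2.IH) auto
      then show ?thesis by (simp add: d_Suc)
    qed
    have "\<bar>d ?m x\<bar> \<le> \<bar>d ?m (x - 1)\<bar> + \<bar>d ?m (\<phi> - x)\<bar> + 56 * (3 / 4) ^ Suc ?m + 56 * (3 / 4) ^ ?m"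
      using False ge2.prems scaled_count_recurrence[of x "Suc ?m"] scaled_count_recurrence[of x ?m]
      unfolding d_def by linarith
    also have "\<dots> \<le> 250 * (3 / 4) ^ m + 250 * (3 / 4) ^ m + 56 * (3 / 4) ^ Suc ?m + 56 * (3 / 4) ^ ?m"
      using small False ge2.prems by (intro add_mono) (auto simp: psi_def)
    also have "\<dots> \<le> 1000 * (3 / 4) ^ ?m" by simp
    finally show ?thesis .
  qed
  then show ?case by (simp add: d_def)
qed

lemma geometric_increments_tendsto_lim:
  fixes f :: "nat \<Rightarrow> 'a::banach"
  assumes increments: "\<And>n. norm (f (Suc n) - f n) \<le> C * r ^ n" and r: "0 \<le> r" "r < 1"
  shows "f \<longlonglongrightarrow> lim f" and "norm (lim f - f n) \<le> C * r ^ n / (1 - r)"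
proof -
  have "summable (\<lambda>n. C * r ^ n)"
    using r by (intro summable_mult) simp
  then have "summable (\<lambda>n. f (Suc n) - f n)"
    by (rule summable_comparison_test') (rule increments)
  then have "convergent (\<lambda>n. f n - f 0)"
    unfolding summable_iff_convergent sum_lessThan_telescope .
  then show lim: "f \<longlonglongrightarrow> lim f"
    using convergent_diff_const_right_iff[of f "f 0"] by (simp add: convergent_LIMSEQ_iff)
  have "(\<lambda>k. f (Suc k + n) - f (k + n)) sums (lim f - f (0 + n))"
    using LIMSEQ_ignore_initial_segment[OF lim, of n] by (rule telescope_sums)
  moreover have "(\<lambda>k. C * r ^ n * r ^ k) sums (C * r ^ n * (1 / (1 - r)))"
    using r by (intro sums_mult geometric_sums) auto
  ultimately have "norm (lim f - f (0 + n)) \<le> C * r ^ n * (1 / (1 - r))"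
    by (rule norm_sums_le) (use increments[of "k + n" for k] in \<open>simp add: power_add mult_ac\<close>)
  then show "norm (lim f - f n) \<le> C * r ^ n / (1 - r)" by simp
qed

definition G :: "real \<Rightarrow> real" where
  "G x = lim (\<lambda>m. scaled_count m x)"

lemma scaled_count_tendsto:
  "0 \<le> x \<Longrightarrow> x \<le> \<phi> \<Longrightarrow> (\<lambda>m. scaled_count m x) \<longlonglongrightarrow> G x"
  unfolding G_def
  by (rule geometric_increments_tendsto_lim(1)[where C = 1000 and r = "3 / 4"])
    (simp_all add: scaled_count_increment)

lemma scaled_count_near_G:
  assumes "0 \<le> x" "x \<le> \<phi>"
  shows "\<bar>scaled_count m x - G x\<bar> \<le> 4000 * (3 / 4) ^ m"
proof -
  have "norm (G x - scaled_count m x) \<le> 1000 * (3 / 4) ^ m / (1 - 3 / 4)"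
    unfolding G_def using assms
    by (intro geometric_increments_tendsto_lim(2)) (simp_all add: scaled_count_increment)
  then show ?thesis by (simp add: abs_minus_commute)
qed

lemma G_mono: "0 \<le> x \<Longrightarrow> x \<le> y \<Longrightarrow> y \<le> \<phi> \<Longrightarrow> G x \<le> G y"
  by (rule LIMSEQ_le[OF scaled_count_tendsto scaled_count_tendsto]) (auto intro: scaled_count_mono)

lemma G_psi_mult:
  assumes "0 \<le> x" "x \<le> \<phi>"
  shows "G (\<psi> * x) = G x / 2"
proof (rule LIMSEQ_unique)
  have "\<psi> * x \<le> \<psi> * \<phi>" using assms by (intro mult_left_mono) auto
  also have "\<dots> \<le> \<phi>" using phi_mult_psi by (simp add: mult.commute)
  finally show "(\<lambda>m. scaled_count (Suc m) (\<psi> * x)) \<longlonglongrightarrow> G (\<psi> * x)"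
    using assms by (intro LIMSEQ_Suc scaled_count_tendsto) auto
  have "scaled_count (Suc m) (\<psi> * x) = scaled_count m x / 2" for m
    by (simp add: scaled_count_Suc phi_mult_psi flip: mult.assoc)
  then show "(\<lambda>m. scaled_count (Suc m) (\<psi> * x)) \<longlonglongrightarrow> G x / 2"
    using assms by (simp only:) (intro tendsto_divide scaled_count_tendsto tendsto_const, simp_all)
qed

lemma G_recurrence:
  assumes "1 \<le> x" "x \<le> \<phi>"
  shows "G x = 1 + G (x - 1) - G (\<phi> - x)"
proof -
  let ?f = "\<lambda>m. scaled_count m x - (1 + scaled_count m (x - 1) - scaled_count m (\<phi> - x))"
  have "?f \<longlonglongrightarrow> G x - (1 + G (x - 1) - G (\<phi> - x))"
    using assms by (intro tendsto_intros scaled_count_tendsto) auto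
  moreover have "(\<lambda>m. 56 * (3 / 4 :: real) ^ m) \<longlonglongrightarrow> 0"
    by (intro tendsto_mult_right_zero LIMSEQ_power_zero) simp
  then have "?f \<longlonglongrightarrow> 0"
    by (rule tendsto_0_le[where K = 1]) (use scaled_count_recurrence[OF assms] in \<open>simp add: always_eventually\<close>)
  ultimately show ?thesis using LIMSEQ_unique by fastforce
qed

lemma G_0: "G 0 = 0"
  using G_psi_mult[of 0] by simp

lemma G_psi: "G \<psi> = 1 / 3"
proof -
  have "G \<psi> = G 1 / 2"
    using G_psi_mult[of 1] by simp
  moreover have "G 1 = 1 - G \<psi>"
    using G_recurrence[of 1] by (simp add: G_0 psi_def)
  ultimately show ?thesis by simp
qed

section \<open>The limit inferior and superior\<close>

definition normalized_count :: "nat \<Rightarrow> real" where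
  "normalized_count H = real (A (int H)) / real H powr fib_exponent"

definition growth :: "real \<Rightarrow> real" where
  "growth x = (x * \<theta> 0) powr fib_exponent"

definition limit_ratio :: "real \<Rightarrow> real" where
  "limit_ratio x = G x / growth x"

lemma fib_exponent_pos: "0 < fib_exponent"
  by (simp add: fib_exponent_def)

lemma phi_powr_exponent: "\<phi> powr fib_exponent = 2"
proof -
  have "ln \<phi> \<noteq> 0" using phi_pos(4) by (metis ln_gt_zero less_irrefl)
  then show ?thesis by (simp add: powr_def fib_exponent_def)
qed

lemma powr_exponent_power:
  assumes "0 < v"
  shows "(v powr fib_exponent) ^ k = (v ^ k) powr fib_exponent"
  using assms by (simp add: powr_powr mult.commute flip: powr_realpow)

lemma phi_power_powr: "(\<phi> ^ k) powr fib_exponent = 2 ^ k"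
  using powr_exponent_power[of \<phi> k] by (simp add: phi_powr_exponent)

lemma theta_powr: "(x * \<theta> m) powr fib_exponent = 2 ^ m * growth x"
proof -
  have "x * \<theta> m = \<phi> ^ m * (x * \<theta> 0)"
    by (simp add: \<theta>_def power_add)
  then show ?thesis
    by (simp only: powr_mult phi_power_powr growth_def)
qed

lemma growth_pos: "0 < x \<Longrightarrow> 0 < growth x"
  by (simp add: growth_def)

lemma growth_mono: "0 \<le> x \<Longrightarrow> x \<le> y \<Longrightarrow> growth x \<le> growth y"
  unfolding growth_def using fib_exponent_pos
  by (intro powr_mono2 mult_right_mono) (auto simp: less_imp_le)

lemma growth_ge_1: "1 \<le> x \<Longrightarrow> 1 \<le> growth x"
proof -
  assume "1 \<le> x"
  have "sqrt 5 \<le> 5 / 2" by (rule real_le_lsqrt) (simp_all add: power2_eq_square)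
  also have "\<dots> \<le> \<phi>\<^sup>2" using phi_bounds by (simp add: power2_eq_square phi_mult_self)
  finally have "sqrt 5 \<le> \<phi>\<^sup>2" .
  then have "1 \<le> growth 1"
    unfolding growth_def \<theta>_def using fib_exponent_pos by (intro ge_one_powr_ge_zero) (auto simp: power2_eq_square)
  also have "\<dots> \<le> growth x" using \<open>1 \<le> x\<close> by (intro growth_mono) auto
  finally show ?thesis .
qed

lemma normalized_count_eq:
  assumes "real H = y * \<theta> m"
  shows "normalized_count H = scaled_count m y / growth y"
proof -
  have "\<lfloor>y * \<theta> m\<rfloor> = int H" by (simp flip: assms)
  then show ?thesis
    by (simp add: normalized_count_def scaled_count_def assms theta_powr)
qed

lemma theta_at_top: "filterlim \<theta> at_top sequentially"
proof -
  have "filterlim (\<lambda>m. \<phi> ^ m) at_top sequentially"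
    by (rule filterlim_realpow_sequentially_gt1[THEN filterlim_at_infinity_imp_filterlim_at_top]) auto
  then have "filterlim (\<lambda>m. (\<phi>\<^sup>2 / sqrt 5) * \<phi> ^ m) at_top sequentially"
    by (intro filterlim_tendsto_pos_mult_at_top[OF tendsto_const]) auto
  then show ?thesis by (simp add: \<theta>_def[abs_def] power2_eq_square mult_ac)
qed

lemma ex_theta_scale:
  assumes "\<theta> M \<le> y"
  obtains m x where "M \<le> m" "1 \<le> x" "x \<le> \<phi>" "y = x * \<theta> m"
proof -
  have "eventually (\<lambda>m. y < \<theta> m) sequentially"
    using theta_at_top by (simp add: filterlim_at_top_dense)
  then obtain N where N: "y < \<theta> m" if "m \<ge> N" for m
    unfolding eventually_sequentially by blast
  have "\<exists>k<N. (\<forall>i\<le>k. \<not> y < \<theta> (M + i)) \<and> y < \<theta> (M + Suc k)"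
    using N[of "M + N"] assms by (intro ex_least_nat_less) auto
  then obtain k where k: "\<not> y < \<theta> (M + k)" "y < \<theta> (Suc (M + k))" by auto
  define x where "x = y / \<theta> (M + k)"
  have "\<theta> (M + k) \<le> y" "y < \<phi> * \<theta> (M + k)"
    using k by (simp_all add: not_less theta_Suc)
  then have "1 \<le> x" "x \<le> \<phi>"
    unfolding x_def by (subst pos_le_divide_eq pos_divide_le_eq; simp)+
  moreover have "y = x * \<theta> (M + k)" by (simp add: x_def)
  ultimately show ?thesis by (intro that[of "M + k" x]) auto
qed

lemma eventually_near_limit_ratio:
  assumes "0 < e"
  shows "eventually (\<lambda>H. \<exists>x. 1 \<le> x \<and> x \<le> \<phi> \<and> \<bar>normalized_count H - limit_ratio x\<bar> < e) sequentially"
proof -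
  have "(\<lambda>m. 4000 * (3 / 4) ^ m :: real) \<longlonglongrightarrow> 0"
    by (intro tendsto_mult_right_zero LIMSEQ_power_zero) simp
  then have "eventually (\<lambda>m. 4000 * (3 / 4) ^ m < e) sequentially"
    using assms by (rule order_tendstoD(2))
  then obtain M where M: "4000 * (3 / 4) ^ m < e" if "m \<ge> M" for m
    unfolding eventually_sequentially by blast
  have "eventually (\<lambda>H. \<theta> M \<le> real H) sequentially"
    using filterlim_real_sequentially by (simp add: filterlim_at_top)
  then show ?thesis
  proof (rule eventually_mono)
    fix H assume "\<theta> M \<le> real H"
    then obtain m x where m: "M \<le> m" and x: "1 \<le> x" "x \<le> \<phi>" and H: "real H = x * \<theta> m"
      by (rule ex_theta_scale)
    have "\<bar>normalized_count H - limit_ratio x\<bar> = \<bar>scaled_count m x - G x\<bar> / growth x"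
      using growth_pos[of x] x(1)
      by (simp add: normalized_count_eq[OF H] limit_ratio_def flip: diff_divide_distrib)
    also have "\<dots> \<le> \<bar>scaled_count m x - G x\<bar>"
      using growth_ge_1[OF x(1)] growth_pos[of x] x(1) by (simp add: pos_divide_le_eq mult_le_cancel_left1)
    also have "\<dots> < e"
      using scaled_count_near_G[of x m] M[OF m] x by simp
    finally show "\<exists>x. 1 \<le> x \<and> x \<le> \<phi> \<and> \<bar>normalized_count H - limit_ratio x\<bar> < e"
      using x by blast
  qed
qed

lemma le_liminf_normalized_count:
  assumes "\<And>x. 1 \<le> x \<Longrightarrow> x \<le> \<phi> \<Longrightarrow> c \<le> limit_ratio x"
  shows "ereal c \<le> liminf (\<lambda>H. ereal (normalized_count H))"
proof (rule ereal_le_epsilon2)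
  fix e :: real assume "0 < e"
  have "eventually (\<lambda>H. ereal (c - e) \<le> ereal (normalized_count H)) sequentially"
    using eventually_near_limit_ratio[OF \<open>0 < e\<close>] by (rule eventually_mono) (use assms in fastforce)
  then have "ereal (c - e) \<le> liminf (\<lambda>H. ereal (normalized_count H))"
    by (rule Liminf_bounded)
  then show "ereal c \<le> liminf (\<lambda>H. ereal (normalized_count H)) + ereal e"
    using add_right_mono[of "ereal (c - e)" _ "ereal e"] by fastforce
qed

lemma limsup_normalized_count_le:
  assumes "\<And>x. 1 \<le> x \<Longrightarrow> x \<le> \<phi> \<Longrightarrow> limit_ratio x \<le> c"
  shows "limsup (\<lambda>H. ereal (normalized_count H)) \<le> ereal c"
proof (rule ereal_le_epsilon2)
  fix e :: real assume "0 < e"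
  have "eventually (\<lambda>H. ereal (normalized_count H) \<le> ereal (c + e)) sequentially"
    using eventually_near_limit_ratio[OF \<open>0 < e\<close>] by (rule eventually_mono) (use assms in fastforce)
  then have "limsup (\<lambda>H. ereal (normalized_count H)) \<le> ereal (c + e)"
    by (rule Limsup_bounded)
  then show "limsup (\<lambda>H. ereal (normalized_count H)) \<le> ereal c + ereal e" by simp
qed

lemma Liminf_le_Liminf_compose:
  fixes f :: "'a \<Rightarrow> 'b::complete_linorder"
  assumes "filterlim h K E"
  shows "Liminf K f \<le> Liminf E (\<lambda>n. f (h n))"
  unfolding le_Liminf_iff using less_LiminfD eventually_compose_filterlim[OF _ assms] by blast

lemma Limsup_compose_le_Limsup:
  fixes f :: "'a \<Rightarrow> 'b::complete_linorder"
  assumes "filterlim h K E"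
  shows "Limsup E (\<lambda>n. f (h n)) \<le> Limsup K f"
  unfolding Limsup_le_iff using Limsup_lessD eventually_compose_filterlim[OF _ assms] by blast

context
  fixes x :: real and H :: "nat \<Rightarrow> nat"
  assumes x: "1 \<le> x" "x \<le> \<phi>"
  defines "H \<equiv> \<lambda>m. nat \<lfloor>x * \<theta> m\<rfloor>"
begin

lemma int_floor_mult_theta: "int (H m) = \<lfloor>x * \<theta> m\<rfloor>"
  using x by (simp add: H_def less_imp_le)

lemma floor_mult_theta_bounds: "x * \<theta> m - 1 \<le> real (H m)" "real (H m) \<le> x * \<theta> m"
  using floor_correct[of "x * \<theta> m"] by (simp_all flip: int_floor_mult_theta)

lemma floor_mult_theta_at_top: "filterlim H at_top sequentially"
proof -
  have "filterlim (\<lambda>m. - 1 + \<theta> m) at_top sequentially"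
    by (rule filterlim_tendsto_add_at_top[OF tendsto_const theta_at_top])
  moreover have "- 1 + \<theta> m \<le> real (H m)" for m
    using floor_mult_theta_bounds(1)[of m] mult_right_mono[OF x(1) less_imp_le[OF theta_pos[of m]]] by linarith
  ultimately have "filterlim (\<lambda>m. real (H m)) at_top sequentially"
    by (auto intro: filterlim_at_top_mono always_eventually)
  then show ?thesis by (simp add: filterlim_sequentially_iff_filterlim_real)
qed

lemma floor_mult_theta_ratio_tendsto: "(\<lambda>m. real (H m) / \<theta> m) \<longlonglongrightarrow> x"
proof (rule real_tendsto_sandwich[OF always_eventually always_eventually])
  show "\<forall>m. real (H m) / \<theta> m \<le> x"
    using floor_mult_theta_bounds(2) by (simp add: pos_divide_le_eq)
  show "\<forall>m. x - 1 / \<theta> m \<le> real (H m) / \<theta> m"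
  proof
    show "x - 1 / \<theta> m \<le> real (H m) / \<theta> m" for m
      using divide_right_mono[OF floor_mult_theta_bounds(1)[of m], of "\<theta> m"]
      by (simp add: diff_divide_distrib less_imp_le)
  qed
  have "(\<lambda>m. 1 / \<theta> m) \<longlonglongrightarrow> 0"
    using tendsto_inverse_0_at_top[OF theta_at_top] by (simp add: inverse_eq_divide)
  then show "(\<lambda>m. x - 1 / \<theta> m) \<longlonglongrightarrow> x"
    using tendsto_diff[OF tendsto_const[of x]] by fastforce
qed simp

lemma normalized_count_tendsto_limit_ratio:
  "(\<lambda>m. normalized_count (H m)) \<longlonglongrightarrow> limit_ratio x"
proof -
  have "(\<lambda>m. growth (real (H m) / \<theta> m)) \<longlonglongrightarrow> growth x"
    unfolding growth_def using x by (intro tendsto_intros floor_mult_theta_ratio_tendsto) auto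
  then have "(\<lambda>m. scaled_count m x / growth (real (H m) / \<theta> m)) \<longlonglongrightarrow> limit_ratio x"
    unfolding limit_ratio_def using x growth_pos[of x] by (intro tendsto_intros scaled_count_tendsto) auto
  moreover have "scaled_count m x / growth (real (H m) / \<theta> m) = normalized_count (H m)" for m
    using normalized_count_eq[of "H m" "real (H m) / \<theta> m" m]
    by (simp add: scaled_count_def flip: int_floor_mult_theta)
  ultimately show ?thesis by simp
qed

lemma liminf_normalized_count_le: "liminf (\<lambda>H. ereal (normalized_count H)) \<le> ereal (limit_ratio x)"
  using Liminf_le_Liminf_compose[OF floor_mult_theta_at_top, of "\<lambda>H. ereal (normalized_count H)"]
    lim_imp_Liminf[OF sequentially_bot tendsto_ereal[OF normalized_count_tendsto_limit_ratio]]
  by simp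

lemma le_limsup_normalized_count: "ereal (limit_ratio x) \<le> limsup (\<lambda>H. ereal (normalized_count H))"
  using Limsup_compose_le_Limsup[OF floor_mult_theta_at_top, of "\<lambda>H. ereal (normalized_count H)"]
    lim_imp_Limsup[OF sequentially_bot tendsto_ereal[OF normalized_count_tendsto_limit_ratio]]
  by simp

end

section \<open>Exact arithmetic in \<open>\<int>[\<phi>]\<close>\<close>

datatype golden = Golden int int

primrec real_of_golden :: "golden \<Rightarrow> real" where
  "real_of_golden (Golden a b) = of_int a + of_int b * \<phi>"

definition golden_of_int :: "int \<Rightarrow> golden" where
  "golden_of_int n = Golden n 0"

text \<open>The sign of \<open>2 (a + b \<phi>) = s + b \<surd>5\<close>.\<close>

fun golden_nonneg :: "golden \<Rightarrow> bool" where
  "golden_nonneg (Golden a b) \<longleftrightarrow>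
    (let s = 2 * a + b in
      if 0 \<le> b then 0 \<le> s \<or> s\<^sup>2 \<le> 5 * b\<^sup>2 else 0 \<le> s \<and> 5 * b\<^sup>2 \<le> s\<^sup>2)"

instantiation golden :: "{one, plus, minus, times, ord}"
begin

definition one_golden :: golden where
  "1 = Golden 1 0"

fun plus_golden :: "golden \<Rightarrow> golden \<Rightarrow> golden" where
  "Golden a b + Golden c d = Golden (a + c) (b + d)"

fun minus_golden :: "golden \<Rightarrow> golden \<Rightarrow> golden" where
  "Golden a b - Golden c d = Golden (a - c) (b - d)"

fun times_golden :: "golden \<Rightarrow> golden \<Rightarrow> golden" where
  "Golden a b * Golden c d = Golden (a * c + b * d) (a * d + b * c + b * d)"

definition less_eq_golden :: "golden \<Rightarrow> golden \<Rightarrow> bool" where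
  "x \<le> y \<longleftrightarrow> golden_nonneg (y - x)"

definition less_golden :: "golden \<Rightarrow> golden \<Rightarrow> bool" where
  "x < y \<longleftrightarrow> \<not> golden_nonneg (x - y)"

instance ..

end

instance golden :: power ..

lemma real_of_golden_of_int [simp]: "real_of_golden (golden_of_int n) = of_int n"
  by (simp add: golden_of_int_def)

lemma real_of_golden_one [simp]: "real_of_golden 1 = 1"
  by (simp add: one_golden_def)

lemma real_of_golden_add [simp]: "real_of_golden (x + y) = real_of_golden x + real_of_golden y"
  by (cases x; cases y) (simp add: algebra_simps)

lemma real_of_golden_diff [simp]: "real_of_golden (x - y) = real_of_golden x - real_of_golden y"
  by (cases x; cases y) (simp add: algebra_simps)

lemma real_of_golden_mult [simp]: "real_of_golden (x * y) = real_of_golden x * real_of_golden y"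
proof -
  obtain a b c d where "x = Golden a b" "y = Golden c d" by (cases x; cases y)
  moreover have "(of_int a + of_int b * \<phi>) * (of_int c + of_int d * \<phi>) =
      of_int (a * c) + of_int (a * d + b * c) * \<phi> + of_int (b * d) * (\<phi> * \<phi>)"
    by (simp add: algebra_simps)
  ultimately show ?thesis by (simp add: phi_mult_self algebra_simps)
qed

lemma real_of_golden_power [simp]: "real_of_golden (x ^ n) = real_of_golden x ^ n"
  by (induction n) simp_all

lemma golden_nonneg_iff: "golden_nonneg x \<longleftrightarrow> 0 \<le> real_of_golden x"
proof -
  obtain a b where x: "x = Golden a b" by (cases x)
  define s where "s = 2 * a + b"
  have "0 \<le> real_of_golden x \<longleftrightarrow> - of_int s \<le> of_int b * sqrt 5"
    by (auto simp: x s_def golden_ratio_def field_simps)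
  moreover have square: "(of_int b * sqrt 5)\<^sup>2 = of_int (5 * b\<^sup>2)" "(of_int s)\<^sup>2 = (of_int (s\<^sup>2) :: real)"
    by (simp_all add: power_mult_distrib)
  have "- of_int s \<le> of_int b * sqrt 5 \<longleftrightarrow> s\<^sup>2 \<le> 5 * b\<^sup>2" if "0 \<le> b" "s < 0"
  proof -
    have "- of_int s \<le> of_int b * sqrt 5 \<longleftrightarrow> (- of_int s)\<^sup>2 \<le> (of_int b * sqrt 5)\<^sup>2"
      using that by (intro power_mono_iff[symmetric]) auto
    then show ?thesis unfolding power2_minus square of_int_le_iff .
  qed
  moreover have "- of_int s \<le> of_int b * sqrt 5 \<longleftrightarrow> 5 * b\<^sup>2 \<le> s\<^sup>2" if "b < 0" "0 \<le> s"
  proof -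
    have "- (of_int b * sqrt 5) \<le> of_int s \<longleftrightarrow> (- (of_int b * sqrt 5))\<^sup>2 \<le> (of_int s)\<^sup>2"
      using that by (intro power_mono_iff[symmetric]) (auto intro: mult_nonpos_nonneg)
    then show ?thesis unfolding power2_minus square of_int_le_iff by linarith
  qed
  moreover have "- of_int s \<le> of_int b * sqrt 5" if "0 \<le> b" "0 \<le> s"
    using that mult_nonneg_nonneg[of "of_int b" "sqrt 5"] by (auto intro: order_trans[of _ 0])
  moreover have "of_int b * sqrt 5 < - of_int s" if "b < 0" "s < 0"
    using that mult_neg_pos[of "of_int b" "sqrt 5"] by (auto intro: less_trans[of _ 0])
  ultimately show ?thesis
    unfolding x golden_nonneg.simps Let_def s_def[symmetric]
    by (cases "0 \<le> b"; cases "0 \<le> s") (simp_all add: not_le)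
qed

lemma golden_le_iff: "x \<le> y \<longleftrightarrow> real_of_golden x \<le> real_of_golden y"
  by (simp add: less_eq_golden_def golden_nonneg_iff)

lemma golden_less_iff: "x < y \<longleftrightarrow> real_of_golden x < real_of_golden y"
  by (simp add: less_golden_def golden_nonneg_iff not_le)

lemma real_of_golden_phi: "real_of_golden (Golden 0 1) = \<phi>"
  by simp

primrec psi_power :: "nat \<Rightarrow> golden" where
  "psi_power 0 = Golden 1 0"
| "psi_power (Suc k) = (case psi_power k of Golden a b \<Rightarrow> Golden (b - a) a)"

lemma real_of_psi_power: "real_of_golden (psi_power k) = \<psi> ^ k"
proof (induction k)
  case (Suc k)
  obtain a b where ab: "psi_power k = Golden a b" by (cases "psi_power k")
  have "\<psi> * (of_int a + of_int b * \<phi>) = of_int a * \<psi> + of_int b * (\<phi> * \<psi>)"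
    by (simp add: algebra_simps)
  also have "\<dots> = of_int (b - a) + of_int a * \<phi>"
    unfolding phi_mult_psi by (simp add: psi_def algebra_simps)
  finally show ?case using Suc.IH by (simp add: ab)
qed simp

lemma real_of_golden_sqrt_5: "real_of_golden (Golden (-1) 2) = sqrt 5"
  by (simp add: golden_ratio_def field_simps)

section \<open>Rational bounds for the growth function\<close>

lemma fib_exponent_gt:
  assumes "0 < q" "\<phi> ^ p < 2 ^ q"
  shows "real p / real q < fib_exponent"
proof -
  have "ln (\<phi> ^ p) < ln (2 ^ q)"
    using assms(2) by (subst ln_less_cancel_iff) auto
  then have "real p * ln \<phi> < real q * ln 2" by (simp add: ln_realpow)
  then show ?thesis
    using assms(1) by (simp add: fib_exponent_def field_simps)
qed

lemma fib_exponent_less: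
  assumes "0 < q" "2 ^ q < \<phi> ^ p"
  shows "fib_exponent < real p / real q"
proof -
  have "ln (2 ^ q) < ln (\<phi> ^ p)"
    using assms(2) by (subst ln_less_cancel_iff) auto
  then have "real q * ln 2 < real p * ln \<phi>" by (simp add: ln_realpow)
  then show ?thesis
    using assms(1) by (simp add: fib_exponent_def field_simps)
qed

lemma fib_exponent_bounds: "278 / 193 < fib_exponent" "fib_exponent < 121 / 84"
proof -
  have "Golden 0 1 ^ 278 < golden_of_int (2 ^ 193)" by code_simp
  then have "\<phi> ^ 278 < 2 ^ 193" by (simp add: golden_less_iff)
  then show "278 / 193 < fib_exponent" using fib_exponent_gt[of 193 278] by simp
  have "golden_of_int (2 ^ 84) < Golden 0 1 ^ 121" by code_simp
  then have "2 ^ 84 < \<phi> ^ 121" by (simp add: golden_less_iff)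
  then show "fib_exponent < 121 / 84" using fib_exponent_less[of 84 121] by simp
qed

lemma fib_exponent_slopes:
  "(fib_exponent - 1) * d \<le> (if d \<le> 0 then 85 / 193 else 37 / 84) * d"
  "(2 - fib_exponent) * d \<le> (if d \<le> 0 then 47 / 84 else 108 / 193) * d"
proof -
  have "(fib_exponent - 1) * d \<le> 85 / 193 * d" "(2 - fib_exponent) * d \<le> 47 / 84 * d" if "d \<le> 0"
    using fib_exponent_bounds that by (intro mult_right_mono_neg; simp)+
  moreover have "(fib_exponent - 1) * d \<le> 37 / 84 * d" "(2 - fib_exponent) * d \<le> 108 / 193 * d" if "0 \<le> d"
    using fib_exponent_bounds that by (intro mult_right_mono; simp)+
  ultimately show
    "(fib_exponent - 1) * d \<le> (if d \<le> 0 then 85 / 193 else 37 / 84) * d"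
    "(2 - fib_exponent) * d \<le> (if d \<le> 0 then 47 / 84 else 108 / 193) * d"
    by simp_all
qed

lemma powr_le_tangent:
  fixes u a :: real
  assumes "0 < u" "0 \<le> a" "a \<le> 1"
  shows "u powr a \<le> 1 + a * (u - 1)"
  using convex_onD[OF exp_convex, of a 0 "ln u"] assms by (simp add: powr_def algebra_simps)

lemma growth_eq:
  assumes "0 < y"
  shows "growth x = growth y * (x / y) powr fib_exponent"
  unfolding growth_def using assms by (simp add: mult.commute flip: powr_mult)

lemma growth_le_tangent:
  assumes "0 < x" "0 < y" and s: "(fib_exponent - 1) * (x / y - 1) \<le> s * (x / y - 1)"
  shows "growth x \<le> growth y * ((x / y) * (1 + s * (x / y - 1)))"
proof -
  define u where "u = x / y"
  have u: "0 < u" using assms by (simp add: u_def)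
  have "u powr fib_exponent = u * u powr (fib_exponent - 1)"
    using u by (simp add: powr_diff)
  also have "\<dots> \<le> u * (1 + (fib_exponent - 1) * (u - 1))"
    using u fib_exponent_bounds by (intro mult_left_mono powr_le_tangent) auto
  also have "\<dots> \<le> u * (1 + s * (u - 1))"
    using u s by (intro mult_left_mono) (auto simp: u_def)
  finally show ?thesis
    unfolding growth_eq[OF assms(2), of x] u_def using growth_pos[OF assms(2)] by (intro mult_left_mono) auto
qed

lemma growth_ge_tangent:
  assumes "0 < x" "0 < y" and s: "(2 - fib_exponent) * (x / y - 1) \<le> s * (x / y - 1)"
  shows "growth y * (x / y)\<^sup>2 \<le> growth x * (1 + s * (x / y - 1))"
proof -
  define u where "u = x / y"
  have u: "0 < u" using assms by (simp add: u_def)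
  have "u powr (2 - fib_exponent) \<le> 1 + (2 - fib_exponent) * (u - 1)"
    using u fib_exponent_bounds by (intro powr_le_tangent) auto
  also have "\<dots> \<le> 1 + s * (u - 1)"
    using s by (simp add: u_def)
  finally have "u powr fib_exponent * u powr (2 - fib_exponent) \<le> u powr fib_exponent * (1 + s * (u - 1))"
    by (intro mult_left_mono) auto
  moreover have "u powr fib_exponent * u powr (2 - fib_exponent) = u\<^sup>2"
    using u by (simp flip: powr_add)
  ultimately have "growth y * u\<^sup>2 \<le> growth y * (u powr fib_exponent * (1 + s * (u - 1)))"
    using growth_pos[OF assms(2)] by (intro mult_left_mono) auto
  then show ?thesis
    unfolding growth_eq[OF assms(2), of x] u_def by (simp only: mult.assoc)
qed

lemma growth_le_root:
  assumes "0 < x" "0 < N" "0 \<le> K" "(x * \<theta> 0) ^ N \<le> \<phi> ^ j" "2 ^ j \<le> K ^ N"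
  shows "growth x \<le> K"
proof -
  have "growth x ^ N = ((x * \<theta> 0) ^ N) powr fib_exponent"
    using assms(1) by (simp add: growth_def powr_exponent_power)
  also have "\<dots> \<le> (\<phi> ^ j) powr fib_exponent"
    using assms fib_exponent_pos by (intro powr_mono2) (auto simp: less_imp_le)
  also have "\<dots> \<le> K ^ N" using assms(5) by (simp add: phi_power_powr)
  finally show ?thesis using assms growth_pos[of x] by (simp add: power_mono_iff)
qed

lemma growth_ge_root:
  assumes "0 < x" "0 < N" "0 \<le> K" "\<phi> ^ j \<le> (x * \<theta> 0) ^ N" "K ^ N \<le> 2 ^ j"
  shows "K \<le> growth x"
proof -
  have "K ^ N \<le> (\<phi> ^ j) powr fib_exponent" using assms(5) by (simp add: phi_power_powr)
  also have "\<dots> \<le> ((x * \<theta> 0) ^ N) powr fib_exponent"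
    using assms fib_exponent_pos by (intro powr_mono2) auto
  also have "\<dots> = growth x ^ N"
    using assms(1) by (simp add: growth_def powr_exponent_power)
  finally show ?thesis using assms growth_pos[of x] by (simp add: power_mono_iff)
qed

type_synonym anchor = "int \<times> int \<times> int \<times> int"

fun upper_anchor :: "anchor \<Rightarrow> bool" where
  "upper_anchor (p, q, k, l) \<longleftrightarrow> 0 < p \<and> 0 < q \<and> 0 < k \<and> 0 < l \<and>
    growth (real_of_int p / real_of_int q) \<le> real_of_int k / real_of_int l"

fun lower_anchor :: "anchor \<Rightarrow> bool" where
  "lower_anchor (p, q, k, l) \<longleftrightarrow> 0 < p \<and> 0 < q \<and> 0 < k \<and> 0 < l \<and>
    real_of_int k / real_of_int l \<le> growth (real_of_int p / real_of_int q)"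

abbreviation theta_numerator :: "int \<Rightarrow> golden" where
  "theta_numerator p \<equiv> Golden 0 1 ^ 2 * golden_of_int p"

abbreviation theta_denominator :: "int \<Rightarrow> golden" where
  "theta_denominator q \<equiv> Golden (-1) 2 * golden_of_int q"

lemma fraction_mult_theta_0:
  "real_of_int p / real_of_int q * \<theta> 0 =
    real_of_golden (theta_numerator p) / real_of_golden (theta_denominator q)"
  by (simp add: \<theta>_def real_of_golden_sqrt_5 mult.commute power2_eq_square del: real_of_golden.simps) simp

lemma upper_anchorI:
  assumes pos: "0 < p" "0 < q" "0 < k" "0 < l" "0 < N"
    and phi: "theta_numerator p ^ N \<le> Golden 0 1 ^ j * theta_denominator q ^ N"
    and two: "2 ^ j * l ^ N \<le> k ^ N"
  shows "upper_anchor (p, q, k, l)"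
proof -
  have "growth (real_of_int p / real_of_int q) \<le> real_of_int k / real_of_int l"
  proof (rule growth_le_root)
    show "(real_of_int p / real_of_int q * \<theta> 0) ^ N \<le> \<phi> ^ j"
      using phi pos unfolding golden_le_iff fraction_mult_theta_0
      by (simp add: power_divide pos_divide_le_eq real_of_golden_sqrt_5 del: real_of_golden.simps)
        (simp add: real_of_golden_phi)
    have "real_of_int (2 ^ j * l ^ N) \<le> real_of_int (k ^ N)"
      using two unfolding of_int_le_iff .
    then show "2 ^ j \<le> (real_of_int k / real_of_int l) ^ N"
      using pos by (simp add: power_divide pos_le_divide_eq)
  qed (use pos in auto)
  then show ?thesis using pos by simp
qed

lemma lower_anchorI:
  assumes pos: "0 < p" "0 < q" "0 < k" "0 < l" "0 < N"
    and phi: "Golden 0 1 ^ j * theta_denominator q ^ N \<le> theta_numerator p ^ N"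
    and two: "k ^ N \<le> 2 ^ j * l ^ N"
  shows "lower_anchor (p, q, k, l)"
proof -
  have "real_of_int k / real_of_int l \<le> growth (real_of_int p / real_of_int q)"
  proof (rule growth_ge_root)
    show "\<phi> ^ j \<le> (real_of_int p / real_of_int q * \<theta> 0) ^ N"
      using phi pos unfolding golden_le_iff fraction_mult_theta_0
      by (simp add: power_divide pos_le_divide_eq real_of_golden_sqrt_5 del: real_of_golden.simps)
        (simp add: real_of_golden_phi)
    have "real_of_int (k ^ N) \<le> real_of_int (2 ^ j * l ^ N)"
      using two unfolding of_int_le_iff .
    then show "(real_of_int k / real_of_int l) ^ N \<le> 2 ^ j"
      using pos by (simp add: power_divide pos_divide_le_eq)
  qed (use pos in auto)
  then show ?thesis using pos by simp
qed

text \<open>The anchors lie close to \<open>1.0377\<close> and \<open>1.3594\<close>, where the ratio attains its minimum and maximum.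
  The fractions are one-sided approximations from continued fractions of \<open>\<surd>5 \<phi>\<^sup>j\<^sup>/\<^sup>N \<phi>\<^sup>-\<^sup>2\<close> and \<open>2\<^sup>j\<^sup>/\<^sup>N\<close>.\<close>

abbreviation min_upper :: anchor where "min_upper \<equiv> (1499, 1444, 6021, 4546)"
abbreviation min_lower :: anchor where "min_lower \<equiv> (3737, 3601, 2285, 1726)"
abbreviation max_upper :: anchor where "max_upper \<equiv> (8882, 6531, 9455, 4838)"
abbreviation max_lower :: anchor where "max_lower \<equiv> (2229, 1639, 1968, 1007)"

lemma upper_anchor_min: "upper_anchor min_upper"
  by (rule upper_anchorI[where j = 15 and N = 37]) code_simp+

lemma lower_anchor_min: "lower_anchor min_lower"
  by (rule lower_anchorI[where j = 17 and N = 42]) code_simp+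

lemma upper_anchor_max: "upper_anchor max_upper"
  by (rule upper_anchorI[where j = 29 and N = 30]) code_simp+

lemma lower_anchor_max: "lower_anchor max_lower"
  by (rule lower_anchorI[where j = 29 and N = 30]) code_simp+

text \<open>Sufficient conditions for \<open>10\<^sup>-\<^sup>8 c growth(x) \<le> g/n\<close> and the reverse inequality, by the tangent at the
  anchor with slope \<open>r/s\<close>, cleared of denominators.\<close>

fun growth_le_test :: "int \<Rightarrow> anchor \<Rightarrow> golden \<Rightarrow> int \<Rightarrow> int \<Rightarrow> bool" where
  "growth_le_test c (p, q, k, l) x g n =
    (let u = golden_of_int q * x; (r, s) = if u \<le> golden_of_int p then (85, 193) else (37, 84) in
      golden_of_int (n * c * k) * (u * (golden_of_int (p * (s - r)) + golden_of_int r * u))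
        \<le> golden_of_int (g * 10 ^ 8 * l * p\<^sup>2 * s))"

fun growth_ge_test :: "int \<Rightarrow> anchor \<Rightarrow> golden \<Rightarrow> int \<Rightarrow> int \<Rightarrow> bool" where
  "growth_ge_test c (p, q, k, l) x g n =
    (let u = golden_of_int q * x; (r, s) = if u \<le> golden_of_int p then (47, 84) else (108, 193) in
      golden_of_int (g * 10 ^ 8 * l * p) * (golden_of_int (p * (s - r)) + golden_of_int r * u)
        \<le> golden_of_int (n * c * k * s) * (u * u))"

lemma growth_le_anchor:
  fixes x p q k l r s :: real
  assumes pos: "0 < x" "0 < p" "0 < q" "0 < s" and anchor: "growth (p / q) \<le> k / l"
    and slope: "(fib_exponent - 1) * (q * x / p - 1) \<le> r / s * (q * x / p - 1)"
  shows "growth x \<le> k * (q * x * (p * (s - r) + r * (q * x))) / (l * p\<^sup>2 * s)"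
proof -
  define t where "t = q * x * (p * (s - r) + r * (q * x)) / (p\<^sup>2 * s)"
  have "growth x \<le> growth (p / q) * (q * x / p * (1 + r / s * (q * x / p - 1)))"
    using growth_le_tangent[of x "p / q" "r / s"] pos slope by (simp add: mult.commute)
  also have "q * x / p * (1 + r / s * (q * x / p - 1)) = t"
    using pos by (simp add: t_def power2_eq_square field_simps)
  finally have growth_le: "growth x \<le> growth (p / q) * t" .
  then have "0 < growth (p / q) * t"
    using growth_pos[OF pos(1)] by (rule less_le_trans[rotated])
  then have "0 < t"
    by (rule zero_less_mult_pos) (use growth_pos[of "p / q"] pos in simp)
  then have "growth x \<le> k / l * t"
    using growth_le anchor by (meson less_imp_le mult_right_mono order_trans)
  then show ?thesis by (simp add: t_def mult.assoc)
qed

lemma growth_ge_anchor: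
  fixes x p q k l r s :: real
  assumes pos: "0 < x" "0 < p" "0 < q" "0 < l" "0 < s" "0 < p * (s - r) + r * (q * x)"
    and anchor: "k / l \<le> growth (p / q)"
    and slope: "(2 - fib_exponent) * (q * x / p - 1) \<le> r / s * (q * x / p - 1)"
  shows "k * s * (q * x)\<^sup>2 / (l * p * (p * (s - r) + r * (q * x))) \<le> growth x"
proof -
  let ?t = "p * (s - r) + r * (q * x)"
  have "k / l * (q * x / p)\<^sup>2 \<le> growth (p / q) * (q * x / p)\<^sup>2"
    using anchor by (intro mult_right_mono) auto
  also have "\<dots> \<le> growth x * (1 + r / s * (q * x / p - 1))"
    using growth_ge_tangent[of x "p / q" "r / s"] pos slope by (simp add: mult.commute)
  also have "1 + r / s * (q * x / p - 1) = ?t / (p * s)"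
    using pos by (simp add: field_simps)
  finally have "k / l * (q * x / p)\<^sup>2 * (p * s / ?t) \<le> growth x * (?t / (p * s)) * (p * s / ?t)"
    using pos by (intro mult_right_mono) auto
  moreover have "k / l * (q * x / p)\<^sup>2 * (p * s / ?t) = k * s * (q * x)\<^sup>2 / (l * p * ?t)"
    using pos by (simp add: power2_eq_square)
  ultimately show ?thesis using pos by simp
qed

lemma growth_le_test_sound:
  assumes "growth_le_test c a x g n" "upper_anchor a"
    and x: "0 < real_of_golden x" and n: "0 < n" and c: "0 < c"
  shows "real_of_int c / 10 ^ 8 * growth (real_of_golden x) \<le> real_of_int g / real_of_int n"
proof -
  obtain p q k l where a: "a = (p, q, k, l)" by (rule prod_cases4)
  have pos: "0 < p" "0 < q" "0 < k" "0 < l" and anchor: "growth (p / q) \<le> k / l"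
    using assms(2) by (auto simp: a)
  define u where "u = q * real_of_golden x"
  obtain r s :: int where rs: "(r, s) = (if u \<le> p then (85, 193) else (37, 84))"
    by (cases "u \<le> p") auto
  have s: "0 < s" using rs by (auto split: if_splits)
  define t where "t = u * (p * (s - r) + r * u)"
  have test: "n * c * k * t \<le> g * 10 ^ 8 * l * p\<^sup>2 * s"
    using assms(1) rs by (auto simp: a t_def u_def golden_le_iff split: if_splits)
  have "(fib_exponent - 1) * (u / p - 1) \<le> r / s * (u / p - 1)"
    using fib_exponent_slopes(1)[of "u / p - 1"] rs pos by (auto split: if_splits)
  then have "growth (real_of_golden x) \<le> k * t / (l * p\<^sup>2 * s)"
    using growth_le_anchor[of "real_of_golden x" p q s k l r] x pos s anchor by (simp add: t_def u_def)
  then have "c / 10 ^ 8 * growth (real_of_golden x) \<le> c / 10 ^ 8 * (k * t / (l * p\<^sup>2 * s))"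
    using c by (intro mult_left_mono) auto
  also have "\<dots> = (n * c * k * t) / (n * 10 ^ 8 * l * p\<^sup>2 * s)"
    using n by simp
  also have "\<dots> \<le> (g * 10 ^ 8 * l * p\<^sup>2 * s) / (n * 10 ^ 8 * l * p\<^sup>2 * s)"
    using test pos s n by (intro divide_right_mono) auto
  also have "\<dots> = g / n" using pos s by simp
  finally show ?thesis .
qed

lemma growth_ge_test_sound:
  assumes "growth_ge_test c a x g n" "lower_anchor a"
    and x: "0 < real_of_golden x" and n: "0 < n" and c: "0 < c"
  shows "real_of_int g / real_of_int n \<le> real_of_int c / 10 ^ 8 * growth (real_of_golden x)"
proof -
  obtain p q k l where a: "a = (p, q, k, l)" by (rule prod_cases4)
  have pos: "0 < p" "0 < q" "0 < k" "0 < l" and anchor: "k / l \<le> growth (p / q)"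
    using assms(2) by (auto simp: a)
  define u where "u = q * real_of_golden x"
  obtain r s :: int where rs: "(r, s) = (if u \<le> p then (47, 84) else (108, 193))"
    by (cases "u \<le> p") auto
  have s: "0 < s" "0 < r" "r < s" using rs by (auto split: if_splits)
  define t where "t = p * (s - r) + r * u"
  have t: "0 < t" using pos x s by (simp add: t_def u_def add_pos_pos)
  have test: "g * 10 ^ 8 * l * p * t \<le> n * c * k * s * u\<^sup>2"
    using assms(1) rs by (auto simp: a t_def u_def golden_le_iff power2_eq_square split: if_splits)
  have "(2 - fib_exponent) * (u / p - 1) \<le> r / s * (u / p - 1)"
    using fib_exponent_slopes(2)[of "u / p - 1"] rs pos by (auto split: if_splits)
  then have growth_ge: "k * s * u\<^sup>2 / (l * p * t) \<le> growth (real_of_golden x)"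
    using growth_ge_anchor[of "real_of_golden x" p q l s r k] x pos s t anchor by (simp add: t_def u_def)
  have "g / n = g * 10 ^ 8 * l * p * t / (n * 10 ^ 8 * l * p * t)"
    using pos t by simp
  also have "\<dots> \<le> n * c * k * s * u\<^sup>2 / (n * 10 ^ 8 * l * p * t)"
    using test pos t n by (intro divide_right_mono) auto
  also have "\<dots> = c / 10 ^ 8 * (k * s * u\<^sup>2 / (l * p * t))"
    using n by simp
  also have "\<dots> \<le> c / 10 ^ 8 * growth (real_of_golden x)"
    using growth_ge c by (intro mult_left_mono) auto
  finally show ?thesis .
qed

section \<open>Branch and bound over cylinders\<close>

lemma phi_eq: "\<phi> = 1 + \<psi>"
  by (simp add: psi_def)

lemma one_plus_psi_mult: "(1 + \<psi>) * \<psi> ^ Suc k = \<psi> ^ k"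
  using phi_mult_psi by (simp add: phi_eq flip: mult.assoc)

lemma psi_power_Suc_Suc: "\<psi> ^ Suc (Suc k) = \<psi> ^ k - \<psi> ^ Suc k"
  using one_plus_psi_mult[of k] by (simp add: algebra_simps)

lemma G_psi_power_mult:
  assumes "0 \<le> t" "t \<le> \<phi>"
  shows "G (\<psi> ^ k * t) = G t / 2 ^ k"
proof (induction k)
  case (Suc k)
  have "\<psi> ^ k * t \<le> 1 * \<phi>"
    using assms by (intro mult_mono power_le_one) auto
  then have "G (\<psi> * (\<psi> ^ k * t)) = G (\<psi> ^ k * t) / 2"
    using assms by (intro G_psi_mult) auto
  with Suc.IH show ?case by (simp add: mult.assoc)
qed simp

lemma G_one_plus:
  "0 \<le> t \<Longrightarrow> t \<le> \<psi> \<Longrightarrow> G (1 + t) = 1 + G t - G (\<psi> - t)"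
  using G_recurrence[of "1 + t"] by (simp add: psi_def algebra_simps)

text \<open>The images of \<open>[0, \<psi>]\<close> under the three maps are \<open>[0, \<psi>\<^sup>3]\<close>, \<open>[\<psi>\<^sup>3, \<psi>\<^sup>2]\<close> and \<open>[\<psi>\<^sup>2, \<psi>]\<close>.\<close>

datatype piece = Lower | Middle | Upper

fun piece_map :: "piece \<Rightarrow> real \<Rightarrow> real" where
  "piece_map Lower t = \<psi>\<^sup>2 * t"
| "piece_map Middle t = \<psi> ^ 3 * (1 + t)"
| "piece_map Upper t = \<psi>\<^sup>2 * (1 + t)"

fun reflected :: "piece \<Rightarrow> piece" where
  "reflected Lower = Upper"
| "reflected Middle = Middle"
| "reflected Upper = Lower"

lemma psi_minus_piece_map: "\<psi> - piece_map d t = piece_map (reflected d) (\<psi> - t)"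
proof -
  have "\<psi>\<^sup>2 * (1 + \<psi>) = \<psi>" "\<psi> ^ 3 * (2 + \<psi>) = \<psi>"
    using psi_power_Suc_Suc[of 0] psi_power_Suc_Suc[of 1] psi_power_Suc_Suc[of 2]
    by (simp_all add: eval_nat_numeral algebra_simps)
  then show ?thesis by (cases d) (simp_all add: algebra_simps)
qed

lemma piece_map_nonneg: "0 \<le> t \<Longrightarrow> 0 \<le> piece_map d t"
  by (cases d) auto

lemma piece_map_le_psi: "t \<le> \<psi> \<Longrightarrow> piece_map d t \<le> \<psi>"
  using piece_map_nonneg[of "\<psi> - t" "reflected d"] by (simp flip: psi_minus_piece_map)

lemma piece_map_cover:
  assumes "0 \<le> t" "t \<le> \<psi>"
  obtains d u where "0 \<le> u" "u \<le> \<psi>" "t = piece_map d u"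
proof -
  have bounds: "(1 + \<psi>) * \<psi> ^ 3 = \<psi>\<^sup>2" "(1 + \<psi>) * \<psi>\<^sup>2 = \<psi>" "\<psi> * \<psi>\<^sup>2 = \<psi> ^ 3"
    using one_plus_psi_mult[of 2] one_plus_psi_mult[of 1] by (simp_all add: eval_nat_numeral)
  consider (lower) "t \<le> \<psi> ^ 3" | (middle) "\<psi> ^ 3 \<le> t" "t \<le> \<psi>\<^sup>2" | (upper) "\<psi>\<^sup>2 \<le> t"
    by linarith
  then show ?thesis
  proof cases
    case lower
    then have "t / \<psi>\<^sup>2 \<le> \<psi>" by (subst pos_divide_le_eq) (simp_all add: bounds)
    then show ?thesis
      using assms by (intro that[of "t / \<psi>\<^sup>2" Lower]) simp_all
  next
    case middle
    then show ?thesis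
      by (intro that[of "t / \<psi> ^ 3 - 1" Middle])
        (simp_all add: pos_divide_le_eq diff_le_eq add.commute bounds)
  next
    case upper
    then show ?thesis
      using assms by (intro that[of "t / \<psi>\<^sup>2 - 1" Upper])
        (simp_all add: pos_divide_le_eq diff_le_eq add.commute bounds)
  qed
qed

lemma G_piece_map:
  assumes "0 \<le> t" "t \<le> \<psi>"
  shows "G (piece_map Lower t) = G t / 4"
    and "G (piece_map Middle t) = (1 + G t - G (\<psi> - t)) / 8"
    and "G (piece_map Upper t) = (1 + G t - G (\<psi> - t)) / 4"
  using assms G_psi_power_mult[of t 2] G_psi_power_mult[of "1 + t" 2] G_psi_power_mult[of "1 + t" 3]
  by (simp_all add: G_one_plus phi_eq)

text \<open>\<open>Cylinder x k c p q\<close> encodes the interval \<open>[x, x + \<psi>\<^sup>k\<^sup>+\<^sup>1]\<close> together with the coefficients of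
  \<open>G\<close> on it.\<close>

datatype cylinder = Cylinder golden nat int int int

fun point :: "cylinder \<Rightarrow> real \<Rightarrow> real" where
  "point (Cylinder x k c p q) t = real_of_golden x + \<psi> ^ k * t"

fun is_cylinder :: "cylinder \<Rightarrow> bool" where
  "is_cylinder (Cylinder x k c p q) \<longleftrightarrow> (\<forall>t\<in>{0..\<psi>}.
    point (Cylinder x k c p q) t \<in> {1..\<phi>} \<and>
    2 ^ k * G (point (Cylinder x k c p q) t) = of_int c + of_int p * G t + of_int q * G (\<psi> - t))"

fun child :: "piece \<Rightarrow> cylinder \<Rightarrow> cylinder" where
  "child Lower (Cylinder x k c p q) = Cylinder x (k + 2) (4 * c + q) (p - q) q"
| "child Middle (Cylinder x k c p q) =
    Cylinder (x + psi_power (k + 3)) (k + 3) (8 * c + p + q) (p - q) (q - p)"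
| "child Upper (Cylinder x k c p q) =
    Cylinder (x + psi_power (k + 2)) (k + 2) (4 * c + p) p (q - p)"

definition root :: cylinder where
  "root = Cylinder (Golden 1 0) 0 1 1 (-1)"

lemma point_root: "point root t = 1 + t"
  by (simp add: root_def)

lemma is_cylinder_root: "is_cylinder root"
  by (auto simp: root_def G_one_plus phi_eq)

lemma point_in_range: "is_cylinder C \<Longrightarrow> 0 \<le> t \<Longrightarrow> t \<le> \<psi> \<Longrightarrow> 1 \<le> point C t \<and> point C t \<le> \<phi>"
  by (cases C) auto

lemma point_mono: "t \<le> u \<Longrightarrow> point C t \<le> point C u"
  by (cases C) (auto intro!: mult_left_mono)

lemma point_child: "point (child d C) t = point C (piece_map d t)"
  by (cases d; cases C)
    (simp_all add: real_of_psi_power power_add power2_eq_square algebra_simps del: psi_power.simps)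

lemma is_cylinder_child:
  assumes "is_cylinder C"
  shows "is_cylinder (child d C)"
proof -
  obtain x k c p q where C: "C = Cylinder x k c p q" by (cases C)
  have range: "point (child d C) t \<in> {1..\<phi>}" if "0 \<le> t" "t \<le> \<psi>" for t
    using point_in_range[OF assms piece_map_nonneg piece_map_le_psi] that by (simp add: point_child)
  have G_point: "2 ^ k * G (point C u) = of_int c + of_int p * G u + of_int q * G (\<psi> - u)"
    if "0 \<le> u" "u \<le> \<psi>" for u
    using assms that by (simp add: C)
  have G_child: "2 ^ (k + j) * G (point (child d C) t) =
      2 ^ j * (of_int c + of_int p * G (piece_map d t) + of_int q * G (piece_map (reflected d) (\<psi> - t)))"
    if "0 \<le> t" "t \<le> \<psi>" for t j
    using that G_point[OF piece_map_nonneg piece_map_le_psi, of t d]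
    by (simp add: point_child power_add psi_minus_piece_map mult.assoc)
  show ?thesis
  proof (cases d)
    case Lower
    have "2 ^ (k + 2) * G (point (child d C) t) =
        of_int (4 * c + q) + of_int (p - q) * G t + of_int q * G (\<psi> - t)"
      if "0 \<le> t" "t \<le> \<psi>" for t
      unfolding G_child[OF that] using that by (simp add: Lower G_piece_map field_simps del: piece_map.simps)
    with range show ?thesis by (simp add: Lower C del: point.simps)
  next
    case Middle
    have "2 ^ (k + 3) * G (point (child d C) t) =
        of_int (8 * c + p + q) + of_int (p - q) * G t + of_int (q - p) * G (\<psi> - t)"
      if "0 \<le> t" "t \<le> \<psi>" for t
      unfolding G_child[OF that] using that by (simp add: Middle G_piece_map field_simps del: piece_map.simps)
    with range show ?thesis by (simp add: Middle C del: point.simps)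
  next
    case Upper
    have "2 ^ (k + 2) * G (point (child d C) t) =
        of_int (4 * c + p) + of_int p * G t + of_int (q - p) * G (\<psi> - t)"
      if "0 \<le> t" "t \<le> \<psi>" for t
      unfolding G_child[OF that] using that by (simp add: Upper G_piece_map field_simps del: piece_map.simps)
    with range show ?thesis by (simp add: Upper C del: point.simps)
  qed
qed

fun left_end :: "cylinder \<Rightarrow> golden" where
  "left_end (Cylinder x k c p q) = x"

fun right_end :: "cylinder \<Rightarrow> golden" where
  "right_end (Cylinder x k c p q) = x + psi_power (k + 1)"

fun left_numerator :: "cylinder \<Rightarrow> int" where
  "left_numerator (Cylinder x k c p q) = 3 * c + q"

fun right_numerator :: "cylinder \<Rightarrow> int" where
  "right_numerator (Cylinder x k c p q) = 3 * c + p"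

fun denominator :: "cylinder \<Rightarrow> int" where
  "denominator (Cylinder x k c p q) = 3 * 2 ^ k"

lemma denominator_pos: "0 < denominator C"
  by (cases C) simp

lemma real_of_left_end: "real_of_golden (left_end C) = point C 0"
  by (cases C) simp

lemma real_of_right_end: "real_of_golden (right_end C) = point C \<psi>"
  by (cases C) (simp add: real_of_psi_power mult.commute del: psi_power.simps)

lemma G_ends:
  assumes "is_cylinder C"
  shows "G (point C 0) = of_int (left_numerator C) / of_int (denominator C)"
    and "G (point C \<psi>) = of_int (right_numerator C) / of_int (denominator C)"
proof -
  obtain x k c p q where C: "C = Cylinder x k c p q" by (cases C)
  have "2 ^ k * G (point C t) = of_int c + of_int p * G t + of_int q * G (\<psi> - t)" if "t \<in> {0, \<psi>}" for t
    using assms that by (auto simp: C)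
  from this[of 0] this[of \<psi>]
  show "G (point C 0) = of_int (left_numerator C) / of_int (denominator C)"
    "G (point C \<psi>) = of_int (right_numerator C) / of_int (denominator C)"
    by (simp_all add: C G_0 G_psi field_simps)
qed

fun check :: "(cylinder \<Rightarrow> bool) \<Rightarrow> nat \<Rightarrow> cylinder \<Rightarrow> bool" where
  "check ok 0 C \<longleftrightarrow> False"
| "check ok (Suc n) C \<longleftrightarrow>
    ok C \<or> check ok n (child Lower C) \<and> check ok n (child Middle C) \<and> check ok n (child Upper C)"

lemma check_imp_all_points:
  assumes ok: "\<And>C t. ok C \<Longrightarrow> is_cylinder C \<Longrightarrow> 0 \<le> t \<Longrightarrow> t \<le> \<psi> \<Longrightarrow> P (point C t)"
    and "check ok n C" "is_cylinder C" "0 \<le> t" "t \<le> \<psi>"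
  shows "P (point C t)"
  using assms(2-)
proof (induction n arbitrary: C t)
  case (Suc n)
  show ?case
  proof (cases "ok C")
    case True
    then show ?thesis using ok Suc.prems by blast
  next
    case False
    obtain d u where u: "0 \<le> u" "u \<le> \<psi>" and t: "t = piece_map d u"
      using piece_map_cover Suc.prems by metis
    have "check ok n (child d C)"
      using Suc.prems(1) False by (cases d) auto
    then have "P (point (child d C) u)"
      using Suc.prems(2) u by (intro Suc.IH is_cylinder_child)
    then show ?thesis by (simp add: point_child t)
  qed
qed simp

lemma check_root_imp:
  assumes "\<And>C t. ok C \<Longrightarrow> is_cylinder C \<Longrightarrow> 0 \<le> t \<Longrightarrow> t \<le> \<psi> \<Longrightarrow> P (point C t)"
    and "check ok n root" "1 \<le> x" "x \<le> \<phi>"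
  shows "P x"
proof -
  have "P (point root (x - 1))"
    by (rule check_imp_all_points[of ok P, OF assms(1,2) is_cylinder_root])
      (use assms(3,4) in \<open>simp_all add: psi_def\<close>)
  then show ?thesis by (simp add: point_root)
qed

definition ratio_ge_test :: "int \<Rightarrow> anchor \<Rightarrow> cylinder \<Rightarrow> bool" where
  "ratio_ge_test c a C \<longleftrightarrow> growth_le_test c a (right_end C) (left_numerator C) (denominator C)"

definition ratio_le_test :: "int \<Rightarrow> anchor \<Rightarrow> cylinder \<Rightarrow> bool" where
  "ratio_le_test c a C \<longleftrightarrow> growth_ge_test c a (left_end C) (right_numerator C) (denominator C)"

lemma ratio_ge_test_sound:
  assumes test: "ratio_ge_test c a C" and a: "upper_anchor a" and c: "0 < c"
    and C: "is_cylinder C" and t: "0 \<le> t" "t \<le> \<psi>"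
  shows "of_int c / 10 ^ 8 \<le> limit_ratio (point C t)"
proof -
  have range: "1 \<le> point C s" "point C s \<le> \<phi>" "0 < point C s" if "s \<in> {0, t, \<psi>}" for s
    using point_in_range[OF C, of s] that t by auto
  have "of_int c / 10 ^ 8 * growth (point C t) \<le> of_int c / 10 ^ 8 * growth (point C \<psi>)"
    using c range(3)[of t] point_mono[OF t(2)] by (intro mult_left_mono growth_mono) auto
  also have "\<dots> \<le> G (point C 0)"
    using growth_le_test_sound[OF test[unfolded ratio_ge_test_def] a _ denominator_pos c] range(3)[of \<psi>]
    by (simp add: G_ends[OF C] real_of_right_end)
  also have "\<dots> \<le> G (point C t)"
    using range[of 0] range(2)[of t] point_mono[OF t(1)] by (intro G_mono) auto
  finally show ?thesis
    using growth_pos[OF range(3)[of t]] by (simp add: limit_ratio_def pos_le_divide_eq)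
qed

lemma ratio_le_test_sound:
  assumes test: "ratio_le_test c a C" and a: "lower_anchor a" and c: "0 < c"
    and C: "is_cylinder C" and t: "0 \<le> t" "t \<le> \<psi>"
  shows "limit_ratio (point C t) \<le> of_int c / 10 ^ 8"
proof -
  have range: "1 \<le> point C s" "point C s \<le> \<phi>" "0 < point C s" if "s \<in> {0, t, \<psi>}" for s
    using point_in_range[OF C, of s] that t by auto
  have "G (point C t) \<le> G (point C \<psi>)"
    using range(3)[of t] range(2)[of \<psi>] point_mono[OF t(2)] by (intro G_mono) auto
  also have "\<dots> \<le> of_int c / 10 ^ 8 * growth (point C 0)"
    using growth_ge_test_sound[OF test[unfolded ratio_le_test_def] a _ denominator_pos c] range(3)[of 0]
    by (simp add: G_ends[OF C] real_of_left_end)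
  also have "\<dots> \<le> of_int c / 10 ^ 8 * growth (point C t)"
    using c range(3)[of 0] point_mono[OF t(1)] by (intro mult_left_mono growth_mono) auto
  finally show ?thesis
    using growth_pos[OF range(3)[of t]] by (simp add: limit_ratio_def pos_divide_le_eq)
qed

definition min_test :: "cylinder \<Rightarrow> bool" where
  "min_test C \<longleftrightarrow> ratio_ge_test 52534710 min_upper C \<or> ratio_ge_test 52534710 max_upper C"

lemma check_min: "check min_test 14 root"
  by code_simp

lemma check_max: "check (ratio_le_test 54338920 max_lower) 13 root"
  by code_simp

lemma limit_ratio_ge:
  assumes "1 \<le> x" "x \<le> \<phi>"
  shows "0.5253471 \<le> limit_ratio x"
proof (rule check_root_imp[where P = "\<lambda>x. 0.5253471 \<le> limit_ratio x", OF _ check_min assms])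
  fix C t assume "min_test C" and C: "is_cylinder C" "0 \<le> t" "t \<le> \<psi>"
  then show "0.5253471 \<le> limit_ratio (point C t)"
    unfolding min_test_def
    using ratio_ge_test_sound[OF _ upper_anchor_min _ C, of 52534710]
      ratio_ge_test_sound[OF _ upper_anchor_max _ C, of 52534710]
    by auto
qed

lemma limit_ratio_le:
  assumes "1 \<le> x" "x \<le> \<phi>"
  shows "limit_ratio x \<le> 0.5433892"
proof (rule check_root_imp[where P = "\<lambda>x. limit_ratio x \<le> 0.5433892", OF _ check_max assms])
  fix C t assume "ratio_le_test 54338920 max_lower C" and C: "is_cylinder C" "0 \<le> t" "t \<le> \<psi>"
  then show "limit_ratio (point C t) \<le> 0.5433892"
    using ratio_le_test_sound[OF _ lower_anchor_max _ C, of 54338920] by auto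
qed

lemma is_cylinder_fold: "is_cylinder C \<Longrightarrow> is_cylinder (fold child ds C)"
  by (induction ds arbitrary: C) (simp_all add: is_cylinder_child)

lemma limit_ratio_left_end_le:
  assumes "growth_ge_test c a (left_end C) (left_numerator C) (denominator C)"
    and "lower_anchor a" "0 < c" and C: "is_cylinder C"
  shows "limit_ratio (point C 0) \<le> of_int c / 10 ^ 8"
proof -
  have pos: "0 < point C 0" using point_in_range[OF C, of 0] by simp
  then have "G (point C 0) \<le> of_int c / 10 ^ 8 * growth (point C 0)"
    using growth_ge_test_sound[OF assms(1,2) _ denominator_pos assms(3)]
    by (simp add: G_ends(1)[OF C] real_of_left_end)
  then show ?thesis using growth_pos[OF pos] by (simp add: limit_ratio_def pos_divide_le_eq)
qed

lemma limit_ratio_left_end_ge: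
  assumes "growth_le_test c a (left_end C) (left_numerator C) (denominator C)"
    and "upper_anchor a" "0 < c" and C: "is_cylinder C"
  shows "of_int c / 10 ^ 8 \<le> limit_ratio (point C 0)"
proof -
  have pos: "0 < point C 0" using point_in_range[OF C, of 0] by simp
  then have "of_int c / 10 ^ 8 * growth (point C 0) \<le> G (point C 0)"
    using growth_le_test_sound[OF assms(1,2) _ denominator_pos assms(3)]
    by (simp add: G_ends(1)[OF C] real_of_left_end)
  then show ?thesis using growth_pos[OF pos] by (simp add: limit_ratio_def pos_le_divide_eq)
qed

text \<open>Following the cylinders that the branch and bound has to split most often leads close to
  the extrema.\<close>

lemma limit_ratio_near_min:
  obtains x where "1 \<le> x" "x \<le> \<phi>" "limit_ratio x \<le> 0.5253489"
proof -
  define C where "C = fold child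
    [Lower, Lower, Middle, Lower, Middle, Lower, Lower, Upper, Lower, Lower, Middle] root"
  have C: "is_cylinder C"
    unfolding C_def by (rule is_cylinder_fold[OF is_cylinder_root])
  have "growth_ge_test 52534890 min_lower (left_end C) (left_numerator C) (denominator C)"
    unfolding C_def by code_simp
  then have "limit_ratio (point C 0) \<le> 0.5253489"
    using limit_ratio_left_end_le[OF _ lower_anchor_min _ C, of 52534890] by simp
  then show ?thesis using point_in_range[OF C, of 0] by (intro that[of "point C 0"]) simp_all
qed

lemma limit_ratio_near_max:
  obtains x where "1 \<le> x" "x \<le> \<phi>" "0.54338782 \<le> limit_ratio x"
proof -
  define C where "C = fold child
    [Middle, Upper, Middle, Upper, Upper, Lower, Upper, Upper, Middle, Upper, Upper] root"
  have C: "is_cylinder C"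
    unfolding C_def by (rule is_cylinder_fold[OF is_cylinder_root])
  have "growth_le_test 54338782 max_upper (left_end C) (left_numerator C) (denominator C)"
    unfolding C_def by code_simp
  then have "0.54338782 \<le> limit_ratio (point C 0)"
    using limit_ratio_left_end_ge[OF _ upper_anchor_max _ C, of 54338782] by simp
  then show ?thesis using point_in_range[OF C, of 0] by (intro that[of "point C 0"]) simp_all
qed

theorem theorem1p3:
  fixes c1 c2 :: ereal
  assumes "c1 = liminf (\<lambda>H::nat. ereal (real (A (int H)) / real H powr fib_exponent))"
    and "c2 = limsup (\<lambda>H::nat. ereal (real (A (int H)) / real H powr fib_exponent))"
  shows "ereal 0.525347 < c1 \<and> c1 < ereal 0.525349 \<and>
         ereal 0.5433878 < c2 \<and> c2 < ereal 0.5433893 \<and>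
         ereal 0.52534 \<le> c1 \<and> c1 < ereal 0.52535 \<and>
         ereal 0.54338 \<le> c2 \<and> c2 < ereal 0.54339"
proof -
  note c_eq = assms[folded normalized_count_def]
  obtain x where x: "1 \<le> x" "x \<le> \<phi>" "limit_ratio x \<le> 0.5253489"
    by (rule limit_ratio_near_min)
  obtain y where y: "1 \<le> y" "y \<le> \<phi>" "0.54338782 \<le> limit_ratio y"
    by (rule limit_ratio_near_max)
  have "ereal 0.5253471 \<le> c1"
    unfolding c_eq by (rule le_liminf_normalized_count[OF limit_ratio_ge])
  moreover have "c1 \<le> ereal 0.5253489"
    unfolding c_eq by (rule order_trans[OF liminf_normalized_count_le[OF x(1,2)]]) (use x(3) in simp)
  moreover have "ereal 0.54338782 \<le> c2"
    unfolding c_eq by (rule order_trans[OF _ le_limsup_normalized_count[OF y(1,2)]]) (use y(3) in simp)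
  moreover have "c2 \<le> ereal 0.5433892"
    unfolding c_eq by (rule limsup_normalized_count_le[OF limit_ratio_le])
  ultimately show ?thesis
    by (cases c1; cases c2) auto
qed

end
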